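(* For every positive integer $n$ and every graph $G$ on $n$ vertices, \[ \operatorname{obs}_c(G) \leq n\lceil \log_2 n \rceil - n + 1. \]
   Context: A geometric drawing of a graph represents its vertices by distinct points in the plane and each edge by the line segment between its endpoints. An obstacle is a polygon in the plane. An obstacle representation of a graph $G$ is a geometric drawing of $G$ together with a set $\mathcal{O}$ of obstacles such that two vertices of $G$ are adjacent if and only if the line segment between the corresponding points is disjoint from all obstacles in $\mathcal{O}$. The convex obstacle number $\operatorname{obs}_c(G)$ is the minimum number of obstacles in an obstacle representation of $G$ in which all obstacles are convex. *)

theory Defs
  imports "HOL-Analysis.Analysis"
begin

definition simple_graph :: "'a set \<Rightarrow> 'a set set \<Rightarrow> bool" where
  "simple_graph V E \<longleftrightarrow> finite V \<and> (\<forall>e\<in>E. \<exists>u\<in>V. \<exists>v\<in>V. u \<noteq> v \<and> e = {u, v})"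

(* The closed region bounded by a simple closed polygonal curve. A Jordan curve is
   polygonal exactly if it is a union of finitely many line segments, so no cyclic
   list of vertices is needed. *)
definition polygon :: "(real^2) set \<Rightarrow> bool" where
  "polygon P \<longleftrightarrow>
     (\<exists>c S. simple_path c \<and> pathfinish c = pathstart c \<and>
            finite S \<and> (\<forall>s\<in>S. \<exists>a b. s = closed_segment a b) \<and> path_image c = \<Union>S \<and>
            P = path_image c \<union> inside (path_image c))"

definition obstacle_representation ::
    "'a set \<Rightarrow> 'a set set \<Rightarrow> ('a \<Rightarrow> real^2) \<Rightarrow> (real^2) set set \<Rightarrow> bool" where
  "obstacle_representation V E p Obs \<longleftrightarrow>
     inj_on p V \<and> (\<forall>P\<in>Obs. polygon P) \<and>
     (\<forall>u\<in>V. \<forall>v\<in>V. u \<noteq> v \<longrightarrow>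
        ({u, v} \<in> E \<longleftrightarrow> (\<forall>P\<in>Obs. closed_segment (p u) (p v) \<inter> P = {})))"

(* Valued in enat because the infimum of the empty set of naturals would be 0. *)
definition convex_obstacle_number :: "'a set \<Rightarrow> 'a set set \<Rightarrow> enat" where
  "convex_obstacle_number V E =
     Inf {enat (card Obs) |p Obs.
            finite Obs \<and> obstacle_representation V E p Obs \<and> (\<forall>P\<in>Obs. convex P)}"

end

theory Submission
  imports Defs "HOL-Complex_Analysis.Contour_Integration"
begin

text \<open>
  Put the vertices \<open>j < n\<close> at the points \<open>(x j, j + \<eta> j\<^sup>2)\<close>, where \<open>\<eta>\<close> is small and \<open>x j\<close> reads
  the binary digits of \<open>j\<close> in a base \<open>M\<close> that is huge compared with \<open>1 / \<eta>\<close>. A pair \<open>u < v\<close> has as its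
  level the highest binary digit \<open>i\<close> in which \<open>u\<close> and \<open>v\<close> differ; two pairs are in the same class if they have
  the same level, agree above digit \<open>i\<close>, and have the same sum \<open>u + v\<close>. There are at most
  \<open>n \<lceil>log\<^sub>2 n\<rceil> - n + 1\<close> classes, by Legendre's formula for \<open>\<Sum>\<^sub>i \<lfloor>(n - 1) / 2\<^sup>i\<rfloor>\<close>.

  The segments of one class nearly meet in a point, and the term \<open>\<eta> j\<^sup>2\<close> bends them into a cap: each of
  them contains a touching point that lies strictly below all others. A segment of another class either
  misses the vertical strip of these touching points, or it belongs to the same bipartite piece and has a
  clearly different height, or it has higher level and is almost horizontal there, at the height of one of
  its end points. In the last case the touching points, which lie a little below the curve at \<open>(u + v) / 2\<close>,
  are again all on one side of it. Hence the convex hull of the touching points of the non-edges in a class,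
  slightly fattened, is a convex obstacle that blocks exactly those non-edges.
\<close>

subsection \<open>Convex polygons\<close>

text \<open>Relative frontiers of bounded convex sets of equal dimension are homeomorphic, so the
  unit circle, parametrised by \<open>circlepath\<close>, can be carried over to the frontier of
  \<open>P\<close>.\<close>

lemma frontier_eq_simple_closed_path:
  fixes P :: "(real^2) set"
  assumes "compact P" "convex P" "interior P \<noteq> {}"
  obtains c where "simple_path c" "pathfinish c = pathstart c" "path_image c = frontier P"
proof -
  have "aff_dim P = 2"
    using aff_dim_nonempty_interior[OF assms(3)] by simp
  moreover have "aff_dim (cball (0::complex) 1) = 2"
    using aff_dim_cball[of 1 "0::complex"] by simp
  ultimately have "rel_frontier (cball (0::complex) 1) homeomorphic rel_frontier P"
    by (intro homeomorphic_rel_frontiers_convex_bounded_sets)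
       (auto simp: assms compact_imp_bounded)
  moreover have "rel_frontier (cball (0::complex) 1) = sphere 0 1"
    using rel_frontier_cball[of "0::complex" 1] by simp
  moreover have "rel_frontier P = frontier P"
    by (rule rel_frontier_frontier[OF affine_hull_nonempty_interior[OF assms(3)]])
  ultimately obtain h k where "homeomorphism (sphere (0::complex) 1) (frontier P) h k"
    unfolding homeomorphic_def by auto
  then have h: "continuous_on (sphere (0::complex) 1) h" "h ` sphere 0 1 = frontier P"
    "inj_on h (sphere 0 1)"
    by (auto simp: homeomorphism_def intro: inj_on_inverseI)
  let ?c = "h \<circ> circlepath 0 1"
  have im: "path_image (circlepath (0::complex) 1) = sphere 0 1" by simp
  show thesis
  proof
    show "simple_path ?c"
      using simple_path_circlepath[of 0 1] h im
      by (auto simp: simple_path_continuous_image)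
    show "pathfinish ?c = pathstart ?c"
      by (simp add: pathfinish_compose pathstart_compose)
    show "path_image ?c = frontier P"
      using h im by (simp add: path_image_compose)
  qed
qed

text \<open>Facets of a plane polytope with interior points are one-dimensional, hence segments;
  finitely many of them cover the frontier.\<close>

lemma polygon_polytope:
  assumes "polytope P" "interior P \<noteq> {}"
  shows "polygon P"
proof -
  have P: "compact P" "convex P" "closed P" "bounded P"
    using assms(1) polytope_imp_compact polytope_imp_convex polytope_imp_closed
      polytope_imp_bounded by blast+
  obtain c where c: "simple_path c" "pathfinish c = pathstart c" "path_image c = frontier P"
    using frontier_eq_simple_closed_path[OF P(1,2) assms(2)] .
  let ?S = "{F. F facet_of P}"
  have "\<Union>?S = frontier P"
    using rel_frontier_of_polyhedron[OF polytope_imp_polyhedron[OF assms(1)]]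
      rel_frontier_frontier[OF affine_hull_nonempty_interior[OF assms(2)]] by simp
  moreover have "\<exists>a b. F = closed_segment a b" if "F facet_of P" for F
  proof -
    have F: "F face_of P" "F \<noteq> {}" "aff_dim F = 1"
      using that aff_dim_nonempty_interior[OF assms(2)] by (auto simp: facet_of_def)
    then have "collinear F" "polytope F"
      using face_of_polytope_polytope[OF assms(1)] by (auto simp: collinear_aff_dim)
    then show ?thesis
      using compact_convex_collinear_segment[OF F(2)] polytope_imp_compact polytope_imp_convex
      by metis
  qed
  moreover have "P = frontier P \<union> inside (frontier P)"
    using P inside_frontier_eq_interior[of P] frontier_def[of P] interior_subset[of P] by auto
  ultimately show ?thesis
    unfolding polygon_def using c finite_polytope_facets[OF assms(1)]
    by (intro exI[of _ c] exI[of _ ?S]) simp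
qed

text \<open>The hull of \<open>F\<close> may be just a point or a segment. Its Minkowski sum with a
  tiny square is still a polytope, has interior points, and moves by less than the positive distance
  to \<open>C\<close>.\<close>

lemma convex_polygon_around_finite_set:
  fixes F :: "(real^2) set"
  assumes "finite F" "F \<noteq> {}" "closed C" "convex hull F \<inter> C = {}"
  obtains P where "polygon P" "convex P" "F \<subseteq> P" "P \<inter> C = {}"
proof -
  obtain \<delta> where \<delta>: "\<delta> > 0" "\<And>x y. x \<in> convex hull F \<Longrightarrow> y \<in> C \<Longrightarrow> \<delta> \<le> dist x y"
    using separate_compact_closed[OF finite_imp_compact_convex_hull[OF assms(1)] assms(3,4)]
    by auto
  obtain S :: "(real^2) set" where S: "finite S" "cbox 0 (\<Sum>Basis) = convex hull S"
    by (rule unit_cube_convex_hull)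
  obtain B where B: "B > 0" "\<And>x. x \<in> convex hull S \<Longrightarrow> norm x \<le> B"
    using bounded_cbox[of 0 "\<Sum>Basis :: real^2"] unfolding S(2) bounded_pos by auto
  define r where "r = \<delta> / (2 * B)"
  have r: "r > 0" "r * B < \<delta>" using \<delta>(1) B(1) by (auto simp: r_def field_simps)
  define T where "T = (*\<^sub>R) r ` S"
  have hT: "convex hull T = (*\<^sub>R) r ` cbox 0 (\<Sum>Basis)"
    unfolding T_def S(2) by (rule convex_hull_scaling)
  define P where "P = convex hull (F + T)"
  have P: "P = convex hull F + convex hull T"
    unfolding P_def by (rule convex_hull_set_plus)
  have "finite (F + T)" using assms(1) S(1) by (simp add: T_def finite_set_plus)
  then have "polytope P" unfolding P_def polytope_def by blast
  obtain q where q: "q \<in> convex hull F" using assms(2) by (metis hull_inc ex_in_conv)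
  let ?U = "(\<lambda>w. q + r *\<^sub>R w) ` box 0 (\<Sum>Basis)"
  have "?U \<subseteq> P"
  proof
    fix z assume "z \<in> ?U"
    then obtain w where w: "w \<in> box 0 (\<Sum>Basis)" "z = q + r *\<^sub>R w" by blast
    then have "r *\<^sub>R w \<in> convex hull T"
      unfolding hT by (intro imageI subsetD[OF box_subset_cbox])
    then show "z \<in> P"
      unfolding P w(2) using q by (rule set_plus_intro[rotated])
  qed
  moreover have "open ?U"
    using r(1) by (intro open_affinity) auto
  moreover have "box 0 (\<Sum>Basis :: real^2) \<noteq> {}"
    unfolding box_ne_empty(2) by simp
  ultimately have "interior P \<noteq> {}"
    using interior_maximal[of ?U P] by auto
  show thesis
  proof
    show "polygon P" by (rule polygon_polytope) fact+
    show "convex P" unfolding P_def by simp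
    have "(0::real^2) \<in> cbox 0 (\<Sum>Basis)"
      by (simp add: mem_box)
    then have "r *\<^sub>R 0 \<in> convex hull T"
      unfolding hT by (rule imageI)
    then have 0: "0 \<in> convex hull T" by simp
    show "F \<subseteq> P"
    proof
      fix x assume "x \<in> F"
      then have "x + 0 \<in> P"
        unfolding P using 0 hull_inc[of x F] by (intro set_plus_intro)
      then show "x \<in> P" by simp
    qed
    show "P \<inter> C = {}"
    proof (rule ccontr)
      assume "P \<inter> C \<noteq> {}"
      then obtain z where z: "z \<in> P" "z \<in> C" by blast
      obtain x y where xy: "z = x + y" "x \<in> convex hull F" "y \<in> convex hull T"
        using z(1) unfolding P by (rule set_plus_elim)
      obtain w where w: "w \<in> convex hull S" "y = r *\<^sub>R w"
        using xy(3) unfolding hT S(2) by blast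
      have "norm y \<le> r * B" using B(2)[OF w(1)] r(1) w(2) by simp
      moreover have "dist x z = norm y" by (simp add: xy dist_norm)
      ultimately show False using \<delta>(2)[OF xy(2) z(2)] r(2) by simp
    qed
  qed
qed

subsection \<open>Counting the classes\<close>

lemma card_nondivisible:
  fixes m N :: nat
  assumes "m > 0"
  shows "card {T \<in> {1..N}. \<not> m dvd T} = N - N div m"
proof -
  have "{T \<in> {1..N}. m dvd T} = (*) m ` {1..N div m}"
  proof (intro equalityI subsetI)
    fix T assume "T \<in> {T \<in> {1..N}. m dvd T}"
    then obtain c where "T = m * c" "1 \<le> T" "T \<le> N" by auto
    moreover have "1 \<le> c" using calculation by (cases c) auto
    moreover have "c \<le> N div m"
      using calculation assms by (metis div_le_mono nonzero_mult_div_cancel_left not_gr_zero)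
    ultimately show "T \<in> (*) m ` {1..N div m}" by auto
  next
    fix T assume "T \<in> (*) m ` {1..N div m}"
    then show "T \<in> {T \<in> {1..N}. m dvd T}"
      using assms by (auto intro: order_trans[OF mult_le_mono2 times_div_less_eq_dividend] simp: Suc_le_eq)
  qed
  then have c: "card {T \<in> {1..N}. m dvd T} = N div m"
    using assms by (simp add: card_image inj_on_def)
  have "{T \<in> {1..N}. \<not> m dvd T} = {1..N} - {T \<in> {1..N}. m dvd T}" by auto
  then have "card {T \<in> {1..N}. \<not> m dvd T} = card {1..N} - card {T \<in> {1..N}. m dvd T}"
    by (metis (no_types, lifting) card_Diff_subset finite_atLeastAtMost finite_subset mem_Collect_eq subsetI)
  then show ?thesis using c by simp
qed

text \<open>By Legendre's formula the sum of the quotients is \<open>N\<close> minus the number of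
  binary ones of \<open>N\<close>, and there are at most \<open>k\<close> of these. The induction
  strips the last digit.\<close>

lemma le_sum_div_powers_of_2:
  fixes N k :: nat
  assumes "N < 2 ^ k"
  shows "N \<le> (\<Sum>i<k. N div 2 ^ Suc i) + k"
  using assms
proof (induction k arbitrary: N)
  case 0
  then show ?case by simp
next
  case (Suc k)
  have "N div 2 < 2 ^ k" using Suc.prems by auto
  from Suc.IH[OF this] have "N div 2 \<le> (\<Sum>i<k. N div 2 ^ Suc (Suc i)) + k"
    by (simp flip: div_mult2_eq)
  then show ?case by (simp add: sum.lessThan_Suc_shift del: sum.lessThan_Suc)
qed

text \<open>Together the conditions say that \<open>u\<close> and \<open>v\<close> agree above
  binary digit \<open>i\<close>, where \<open>u\<close> has 0 and \<open>v\<close> has 1.\<close>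

definition at_level :: "nat \<Rightarrow> nat \<Rightarrow> nat \<Rightarrow> bool" where
  "at_level i u v \<longleftrightarrow> v div 2 ^ i = Suc (u div 2 ^ i) \<and> even (u div 2 ^ i)"

definition level :: "nat \<Rightarrow> nat \<Rightarrow> nat" where
  "level u v = (LEAST i. u div 2 ^ Suc i = v div 2 ^ Suc i)"

lemma at_level_level:
  assumes "u < v"
  shows "at_level (level u v) u v"
proof -
  let ?P = "\<lambda>i. u div 2 ^ Suc i = v div 2 ^ Suc i" and ?i = "level u v"
  have "v < 2 ^ Suc v"
    using less_exp[of "Suc v"] by simp
  then have "?P v" using assms by simp
  then have eq: "?P ?i" unfolding level_def by (rule LeastI)
  have "u div 2 ^ ?i \<noteq> v div 2 ^ ?i"
  proof (cases ?i)
    case 0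
    then show ?thesis using assms by simp
  next
    case (Suc j)
    then show ?thesis using not_less_Least[of j ?P] unfolding level_def by simp
  qed
  moreover have "u div 2 ^ ?i div 2 = v div 2 ^ ?i div 2"
    using eq by (simp add: div_mult2_eq mult.commute flip: div_mult2_eq)
  moreover have "u div 2 ^ ?i \<le> v div 2 ^ ?i"
    using assms by (simp add: div_le_mono)
  moreover have "b = Suc a \<and> even a" if "a \<noteq> b" "a div 2 = b div 2" "a \<le> b" for a b :: nat
    using that by presburger
  ultimately show ?thesis unfolding at_level_def by blast
qed

lemma level_less:
  assumes "u < v" "v < 2 ^ k"
  shows "level u v < k"
proof -
  obtain j where j: "k = Suc j" using assms by (cases k) auto
  then have "level u v \<le> j"
    unfolding level_def using assms by (intro Least_le) simp
  then show ?thesis using j by simp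
qed

lemma at_level_decomp:
  assumes "at_level i u v"
  obtains b l l' where "u = 2 ^ Suc i * b + l" "v = 2 ^ Suc i * b + 2 ^ i + l'"
    "l < 2 ^ i" "l' < 2 ^ i"
proof -
  obtain b where b: "u div 2 ^ i = 2 * b" "v div 2 ^ i = Suc (2 * b)"
    using assms unfolding at_level_def by (auto elim: evenE)
  show thesis
  proof
    show "u = 2 ^ Suc i * b + u mod 2 ^ i"
      using b div_mult_mod_eq[of u "2 ^ i"] by (simp add: algebra_simps)
    show "v = 2 ^ Suc i * b + 2 ^ i + v mod 2 ^ i"
      using b div_mult_mod_eq[of v "2 ^ i"] by (simp add: algebra_simps)
  qed simp_all
qed

text \<open>If \<open>b\<close> is the index of the block of length \<open>2 ^ (i + 1)\<close> containing a pair of level \<open>i\<close>, then the second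
  component is \<open>T = u + v + 1 - 2 ^ i - 2 ^ (i + 1) * b\<close>. It lies in this block itself, so it encodes
  both the block and the sum, and it is never a multiple of \<open>2 ^ (i + 1)\<close>.\<close>

definition pair_key :: "nat \<Rightarrow> nat \<Rightarrow> nat \<times> nat" where
  "pair_key u v = (level u v, Suc (v + u mod 2 ^ level u v - 2 ^ level u v))"

lemma pair_key_decode:
  assumes "u < v" "pair_key u v = (i, T)"
  shows "at_level i u v" "u div 2 ^ Suc i = T div 2 ^ Suc i"
    "u + v + 1 = 2 ^ Suc i * (T div 2 ^ Suc i) + 2 ^ i + T"
    "T \<le> v" "1 \<le> T" "\<not> 2 ^ Suc i dvd T"
proof -
  have i: "i = level u v" using assms(2) by (simp add: pair_key_def)
  show lev: "at_level i u v" unfolding i by (rule at_level_level[OF assms(1)])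
  obtain b l l' where d: "u = 2 ^ Suc i * b + l" "v = 2 ^ Suc i * b + 2 ^ i + l'"
    "l < 2 ^ i" "l' < 2 ^ i"
    using at_level_decomp[OF lev] .
  have "u mod 2 ^ i = l"
    using d(3) mod_mult_self4[of "2 ^ i" "2 * b" l] unfolding d(1) by (simp add: mult_ac)
  then have T: "T = 2 ^ Suc i * b + (l + l' + 1)"
    using assms(2) unfolding pair_key_def i[symmetric] by (simp add: d(2))
  \<comment> \<open>So the remainder \<open>l + l' + 1\<close> of \<open>T\<close> lies between 1
    and \<open>2 ^ Suc i - 1\<close>. The successor in \<open>pair_key\<close> makes it positive,
    which excludes the multiples of \<open>2 ^ Suc i\<close>.\<close>
  have lt: "l + l' + 1 < 2 ^ Suc i" using d(3,4) by simp
  have quot: "(m * b + r) div m = b" "(m * b + r) mod m = r" if "r < m" for m b r :: nat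
    using that by simp_all
  have Tb: "T div 2 ^ Suc i = b"
    unfolding T by (rule quot(1)[OF lt])
  show "u div 2 ^ Suc i = T div 2 ^ Suc i"
    unfolding Tb d(1) using d(3) by simp
  show "u + v + 1 = 2 ^ Suc i * (T div 2 ^ Suc i) + 2 ^ i + T"
    unfolding Tb using d T by simp
  show "T \<le> v" "1 \<le> T" using d(2,3) T by simp_all
  have "T mod 2 ^ Suc i = l + l' + 1"
    unfolding T by (rule quot(2)[OF lt])
  then show "\<not> 2 ^ Suc i dvd T" by (simp add: dvd_eq_mod_eq_0)
qed

definition class_keys :: "nat \<Rightarrow> nat \<Rightarrow> (nat \<times> nat) set" where
  "class_keys n k = (SIGMA i:{..<k}. {T \<in> {1..n-1}. \<not> 2 ^ Suc i dvd T})"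

lemma finite_class_keys: "finite (class_keys n k)"
  unfolding class_keys_def by simp

text \<open>With \<open>N = n - 1\<close>, the terms subtracted over all levels add up to at least
  \<open>N - k\<close>, and \<open>k * N - (N - k) = n * k - n + 1\<close>. Having \<open>n\<close>
  on the left avoids truncated subtraction.\<close>

lemma card_class_keys:
  assumes "n \<ge> 1" "n \<le> 2 ^ k"
  shows "card (class_keys n k) + n \<le> n * k + 1"
proof -
  define N where "N = n - 1"
  have n: "n = Suc N" using assms(1) N_def by simp
  have "card (class_keys n k) = (\<Sum>i<k. N - N div 2 ^ Suc i)"
    unfolding class_keys_def N_def[symmetric] by (simp add: card_nondivisible del: power_Suc One_nat_def atLeastAtMost_iff)
  moreover have "(\<Sum>i<k. N - N div 2 ^ Suc i) + (\<Sum>i<k. N div 2 ^ Suc i) = k * N"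
    unfolding sum.distrib[symmetric] by simp
  moreover have "N \<le> (\<Sum>i<k. N div 2 ^ Suc i) + k"
    using assms n by (intro le_sum_div_powers_of_2) simp
  ultimately show ?thesis unfolding n by (simp add: algebra_simps)
qed

lemma pair_key_in_class_keys:
  assumes "u < v" "v < n" "n \<le> 2 ^ k"
  shows "pair_key u v \<in> class_keys n k"
proof -
  obtain i T where key: "pair_key u v = (i, T)" by fastforce
  then have "i < k"
    using level_less[of u v k] assms by (simp add: pair_key_def)
  moreover have "T \<in> {1..n - 1}" "\<not> 2 ^ Suc i dvd T"
    using pair_key_decode(4-6)[OF assms(1) key] assms(2) by auto
  ultimately show ?thesis
    unfolding key class_keys_def by blast
qed

subsection \<open>The drawing\<close>

fun xpos :: "real \<Rightarrow> nat \<Rightarrow> real" where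
  "xpos M j = (if j = 0 then 0 else real (j mod 2) + M * xpos M (j div 2))"

declare xpos.simps [simp del]

lemma xpos_0 [simp]: "xpos M 0 = 0"
  by (simp add: xpos.simps)

lemma xpos_rec: "xpos M j = real (j mod 2) + M * xpos M (j div 2)"
  by (cases "j = 0") (simp_all add: xpos.simps[of M j])

lemma xpos_split:
  assumes "l < 2 ^ i"
  shows "xpos M (2 ^ i * m + l) = M ^ i * xpos M m + xpos M l"
  using assms
proof (induction i arbitrary: l)
  case 0
  then show ?case by simp
next
  case (Suc i)
  have "(2 ^ Suc i * m + l) div 2 = 2 ^ i * m + l div 2" "(2 ^ Suc i * m + l) mod 2 = l mod 2"
    by (simp_all add: mult.assoc)
  moreover have "l div 2 < 2 ^ i" using Suc.prems by auto
  ultimately show ?case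
    using Suc.IH[of "l div 2"] xpos_rec[of M "2 ^ Suc i * m + l"] xpos_rec[of M l]
    by (simp add: algebra_simps)
qed

lemma xpos_bounds:
  assumes "M \<ge> 2" "l < 2 ^ i"
  shows "0 \<le> xpos M l" "M * xpos M l \<le> 2 * M ^ i"
proof -
  \<comment> \<open>The factor \<open>M - 1\<close> of the geometric series makes the induction go
    through; \<open>M \<ge> 2\<close> then gives \<open>M \<le> 2 * (M - 1)\<close>.\<close>
  have "0 \<le> xpos M l \<and> (M - 1) * xpos M l \<le> M ^ i - 1"
    using assms(2)
  proof (induction i arbitrary: l)
    case 0
    then show ?case by simp
  next
    case (Suc i)
    let ?y = "xpos M (l div 2)"
    have IH: "0 \<le> ?y" "(M - 1) * ?y \<le> M ^ i - 1"
      using Suc by auto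
    have "xpos M l \<le> 1 + M * ?y"
      using xpos_rec[of M l] by simp
    then have "(M - 1) * xpos M l \<le> (M - 1) * (1 + M * ?y)"
      using assms(1) by (intro mult_left_mono) auto
    also have "\<dots> = (M - 1) + M * ((M - 1) * ?y)" by (simp add: algebra_simps)
    also have "\<dots> \<le> (M - 1) + M * (M ^ i - 1)"
      using IH(2) assms(1) by (intro add_left_mono mult_left_mono) auto
    finally show ?case
      using IH(1) assms(1) xpos_rec[of M l] by (simp add: algebra_simps)
  qed
  then have *: "0 \<le> xpos M l" "(M - 1) * xpos M l \<le> M ^ i - 1" by auto
  then have "M * xpos M l \<le> 2 * ((M - 1) * xpos M l)"
    using mult_right_mono[of 2 M "xpos M l"] assms(1) by (simp add: algebra_simps)
  with * show "0 \<le> xpos M l" "M * xpos M l \<le> 2 * M ^ i" by linarith+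
qed

text \<open>A gap of 1 between the halves becomes a gap of \<open>M \<ge> 2\<close>, of which the
  last digits can cost at most 1.\<close>

lemma xpos_gap:
  assumes "M \<ge> 2" "u < v"
  shows "xpos M u + 1 \<le> xpos M v"
  using assms(2)
proof (induction v arbitrary: u rule: less_induct)
  case (less v)
  show ?case
  proof (cases "u div 2 = v div 2")
    case True
    then have "u mod 2 = 0" "v mod 2 = 1" using less.prems by presburger+
    then show ?thesis using xpos_rec[of M u] xpos_rec[of M v] True by simp
  next
    case False
    then have "u div 2 < v div 2" using less.prems by presburger
    then have "xpos M (u div 2) + 1 \<le> xpos M (v div 2)" using less by simp
    then have "M * (xpos M (u div 2) + 1) \<le> M * xpos M (v div 2)"
      using assms(1) by (intro mult_left_mono) auto
    moreover have "xpos M u \<le> 1 + M * xpos M (u div 2)"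
      using xpos_rec[of M u] by simp
    moreover have "M * xpos M (v div 2) \<le> xpos M v"
      using xpos_rec[of M v] by simp
    ultimately show ?thesis using assms(1) by (simp add: algebra_simps)
  qed
qed

lemma xpos_mono:
  assumes "M \<ge> 2" "u \<le> v"
  shows "xpos M u \<le> xpos M v"
  using xpos_gap[OF assms(1), of u v] assms(2) by (cases "u = v") auto

text \<open>The digits from \<open>i\<close> on fix a cell of width \<open>2 / M * M ^ i\<close>.
  For large \<open>M\<close> this is tiny against the distance between cells, so points of one cell
  are nearly interchangeable horizontally.\<close>

lemma xpos_cell:
  assumes "M \<ge> 2"
  shows "M ^ i * xpos M (u div 2 ^ i) \<le> xpos M u"
    "xpos M u \<le> M ^ i * xpos M (u div 2 ^ i) + 2 / M * M ^ i"
proof -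
  have "xpos M u = M ^ i * xpos M (u div 2 ^ i) + xpos M (u mod 2 ^ i)"
    using xpos_split[of "u mod 2 ^ i" i M "u div 2 ^ i"] by simp
  moreover have "0 \<le> xpos M (u mod 2 ^ i)" "M * xpos M (u mod 2 ^ i) \<le> 2 * M ^ i"
    using xpos_bounds[OF assms, of "u mod 2 ^ i" i] by simp_all
  moreover have "xpos M (u mod 2 ^ i) \<le> 2 / M * M ^ i"
    using calculation(3) assms by (simp add: field_simps)
  ultimately show "M ^ i * xpos M (u div 2 ^ i) \<le> xpos M u"
    "xpos M u \<le> M ^ i * xpos M (u div 2 ^ i) + 2 / M * M ^ i" by linarith+
qed

lemma xpos_Suc_even: "even m \<Longrightarrow> xpos M (Suc m) = xpos M m + 1"
  using xpos_rec[of M m] xpos_rec[of M "Suc m"] by (auto elim!: evenE)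

section \<open>Separating a convex hull from a segment\<close>

lemma convex_hull_Int_segment_eq_empty:
  fixes Q :: "'a::real_inner set"
  assumes "\<And>z. z \<in> Q \<Longrightarrow> a \<bullet> z < c" "c \<le> a \<bullet> p" "c \<le> a \<bullet> p'"
  shows "convex hull Q \<inter> closed_segment p p' = {}"
proof -
  have "convex hull Q \<subseteq> {z. a \<bullet> z < c}"
    using assms(1) by (intro hull_minimal convex_halfspace_lt) auto
  moreover have "closed_segment p p' \<subseteq> {z. a \<bullet> z \<ge> c}"
    using assms(2,3) by (intro closed_segment_subset convex_halfspace_ge) auto
  ultimately show ?thesis by fastforce
qed

definition line_through :: "real^2 \<Rightarrow> real^2 \<Rightarrow> real \<Rightarrow> real" where
  "line_through p p' x = p $ 2 + (x - p $ 1) / (p' $ 1 - p $ 1) * (p' $ 2 - p $ 2)"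

text \<open>Each alternative puts \<open>Q\<close>, hence its hull, into an open half-plane that
  misses the segment, bounded by a vertical line through an end or by the line of the
  segment.\<close>

lemma convex_hull_Int_segment_eq_empty_2:
  fixes Q :: "(real^2) set"
  assumes "p $ 1 < p' $ 1"
    and "(\<forall>z\<in>Q. z $ 1 < p $ 1) \<or> (\<forall>z\<in>Q. p' $ 1 < z $ 1) \<or>
         (\<forall>z\<in>Q. z $ 2 < line_through p p' (z $ 1)) \<or>
         (\<forall>z\<in>Q. line_through p p' (z $ 1) < z $ 2)"
  shows "convex hull Q \<inter> closed_segment p p' = {}"
proof -
  define s where "s = (p' $ 2 - p $ 2) / (p' $ 1 - p $ 1)"
  have L: "line_through p p' x = p $ 2 + (x - p $ 1) * s" for x
    unfolding line_through_def s_def by simp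
  have s: "p' $ 2 = p $ 2 + (p' $ 1 - p $ 1) * s"
    using assms(1) by (simp add: s_def)
  note [simp] = inner_vec_def sum_2
  from assms(2) show ?thesis
  proof (elim disjE)
    assume "\<forall>z\<in>Q. z $ 1 < p $ 1"
    then show ?thesis
      using assms(1)
      by (intro convex_hull_Int_segment_eq_empty[where a = "vector [1, 0]" and c = "p $ 1"]) auto
  next
    assume "\<forall>z\<in>Q. p' $ 1 < z $ 1"
    then show ?thesis
      using assms(1)
      by (intro convex_hull_Int_segment_eq_empty[where a = "vector [-1, 0]" and c = "- p' $ 1"]) auto
  next
    assume "\<forall>z\<in>Q. z $ 2 < line_through p p' (z $ 1)"
    then show ?thesis
      unfolding L
      by (intro convex_hull_Int_segment_eq_empty
          [where a = "vector [-s, 1]" and c = "p $ 2 - p $ 1 * s"])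
         (auto simp: s algebra_simps)
  next
    assume "\<forall>z\<in>Q. line_through p p' (z $ 1) < z $ 2"
    then show ?thesis
      unfolding L
      by (intro convex_hull_Int_segment_eq_empty
          [where a = "vector [s, -1]" and c = "p $ 1 * s - p $ 2"])
         (auto simp: s algebra_simps)
  qed
qed

lemma convex_combination_bounds:
  fixes t :: real
  assumes "a \<le> x" "x \<le> b" "a \<le> y" "y \<le> b" "0 \<le> t" "t \<le> 1"
  shows "a \<le> (1 - t) * x + t * y" "(1 - t) * x + t * y \<le> b"
proof -
  have "(1 - t) * a + t * a \<le> (1 - t) * x + t * y" "(1 - t) * x + t * y \<le> (1 - t) * b + t * b"
    using assms by (intro add_mono mult_left_mono; simp)+
  then show "a \<le> (1 - t) * x + t * y" "(1 - t) * x + t * y \<le> b"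
    by (simp_all add: algebra_simps)
qed

text \<open>\<open>N\<close> bounds the vertex indices. The bound on \<open>\<eta>\<close> keeps the
  quadratic part of a height at most 1/16, small against the half unit between means of different
  sums. The bound on \<open>M\<close> keeps the height error caused by the width of the cells within
  \<open>\<eta> / 128\<close>, below the gaps \<open>\<eta> / 2\<close> and
  \<open>\<eta> / 4\<close> that must be detected.\<close>

locale dyadic_drawing =
  fixes N \<eta> M :: real
  assumes N: "N \<ge> 1" and \<eta>_pos: "\<eta> > 0" and \<eta>_small: "16 * \<eta> * N\<^sup>2 \<le> 1"
    and M_large: "1024 * N \<le> M * \<eta>"
begin

section \<open>Heights and touching points\<close>

definition ht :: "real \<Rightarrow> real" where
  "ht z = z + \<eta> * z\<^sup>2"

definition pt :: "nat \<Rightarrow> real^2" where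
  "pt j = vector [xpos M j, ht (real j)]"

text \<open>For the pairs with a fixed sum and \<open>w = (v - u) / 2\<close>, the height of the segment at the parameter
  \<open>1 / 2 + \<tau>\<close> is, up to lower order terms, a constant plus \<open>2 \<tau> w + \<eta> w\<^sup>2\<close>. At \<open>\<tau> = - \<eta> w\<close> the segment with
  parameter \<open>w\<close> is therefore the lowest one, with a gap of \<open>\<eta> (w' - w)\<^sup>2\<close> to the segment \<open>w'\<close>.\<close>

definition split_param :: "real \<Rightarrow> real \<Rightarrow> real" where
  "split_param u v = 1 / 2 - \<eta> * (v - u) / 2"

definition touch :: "nat \<Rightarrow> nat \<Rightarrow> real^2" where
  "touch u v = (1 - split_param u v) *\<^sub>R pt u + split_param u v *\<^sub>R pt v"

lemma pt_simps [simp]: "pt j $ 1 = xpos M j" "pt j $ 2 = ht (real j)"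
  by (simp_all add: pt_def)

text \<open>This range leaves a touching point strictly between the two cells that contain the ends
  of its segment.\<close>

lemma split_param_bounds:
  assumes "0 \<le> u" "u \<le> v" "v \<le> N"
  shows "1 / 4 \<le> split_param u v" "split_param u v \<le> 1 / 2"
proof -
  have "\<eta> * (v - u) \<le> \<eta> * N"
    using assms \<eta>_pos by simp
  also have "\<dots> \<le> \<eta> * N\<^sup>2"
    using N \<eta>_pos by (simp add: power2_eq_square)
  finally show "1 / 4 \<le> split_param u v"
    using \<eta>_small unfolding split_param_def by simp
  show "split_param u v \<le> 1 / 2"
    using assms \<eta>_pos unfolding split_param_def by simp
qed

lemma M_bounds: "M \<ge> 16" "8 * N / M \<le> \<eta> / 128"
proof -
  have "\<eta> * 1 \<le> \<eta> * N\<^sup>2" using N \<eta>_pos by (intro mult_left_mono) auto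
  then have \<eta>: "\<eta> \<le> 1" using \<eta>_small by simp
  have "M > 0" using M_large N \<eta>_pos by (smt (verit) mult_nonpos_nonneg)
  then have "M * \<eta> \<le> M" using \<eta> by simp
  then show "M \<ge> 16" using M_large N by linarith
  then show "8 * N / M \<le> \<eta> / 128" using M_large by (simp add: field_simps)
qed

text \<open>The deviation is the difference of two terms in \<open>[0, \<eta> * N\<^sup>2]\<close>,
  one from the quadratic heights and one from the shift of the parameter. Means of different integer
  sums are 1/2 apart, so this error cannot reverse their order.\<close>

lemma touch_height_near_mean:
  assumes "0 \<le> u" "u \<le> v" "v \<le> N" "0 \<le> u'" "u' \<le> v'" "v' \<le> N"
  defines "t \<equiv> split_param u v"
  shows "\<bar>(1 - t) * ht u' + t * ht v' - (u' + v') / 2\<bar> \<le> 1 / 16"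
proof -
  have t: "0 \<le> t" "t \<le> 1"
    using split_param_bounds[OF assms(1-3)] by (auto simp: t_def)
  have "(1 - t) * u'\<^sup>2 + t * v'\<^sup>2 \<le> (1 - t) * N\<^sup>2 + t * N\<^sup>2"
    using assms t by (intro add_mono mult_left_mono power_mono) auto
  also have "\<dots> = N\<^sup>2" by (simp add: algebra_simps)
  finally have 1: "\<eta> * ((1 - t) * u'\<^sup>2 + t * v'\<^sup>2) \<le> \<eta> * N\<^sup>2"
    using \<eta>_pos by simp
  have 2: "0 \<le> \<eta> * ((1 - t) * u'\<^sup>2 + t * v'\<^sup>2)"
    using \<eta>_pos t by simp
  have "(v - u) * (v' - u') \<le> N * N"
    using assms by (intro mult_mono) auto
  then have 3: "\<eta> * ((v - u) * (v' - u')) \<le> \<eta> * N\<^sup>2"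
    using \<eta>_pos by (simp add: power2_eq_square)
  have 4: "0 \<le> \<eta> * ((v - u) * (v' - u'))"
    using assms \<eta>_pos by simp
  have "(1 - t) * ht u' + t * ht v' - (u' + v') / 2
    = \<eta> * ((1 - t) * u'\<^sup>2 + t * v'\<^sup>2) - \<eta> * ((v - u) * (v' - u')) / 2"
    unfolding ht_def t_def split_param_def by (simp add: algebra_simps) (simp add: field_simps)
  moreover have "16 * (\<eta> * N\<^sup>2) \<le> 1" using \<eta>_small by (simp add: mult.assoc)
  ultimately show ?thesis using 1 2 3 4 unfolding abs_le_iff by linarith
qed

lemma touch_below_same_sum:
  assumes "0 \<le> u" "u \<le> v" "v \<le> N" "u + v = u' + v'" "1 \<le> \<bar>u' - u\<bar>"
  defines "t \<equiv> split_param u v"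
  shows "(1 - t) * ht u + t * ht v + \<eta> / 2 \<le> (1 - t) * ht u' + t * ht v'"
proof -
  define w d \<sigma> where "w = (v - u) / 2" "d = u - u'" "\<sigma> = (u + v) / 2"
  have eq: "u = \<sigma> - w" "v = \<sigma> + w" "u' = \<sigma> - w - d" "v' = \<sigma> + w + d" "t = 1 / 2 - \<eta> * w"
    using assms(4) unfolding w_d_\<sigma>_def t_def split_param_def by (simp_all add: field_simps)
  \<comment> \<open>The choice of \<open>t\<close> cancels the terms in
    \<open>\<eta> * w * d\<close>. The remaining cross term is of second order in
    \<open>\<eta>\<close>: inside the bracket it is at most \<open>\<bar>d\<bar> / 2\<close>, while
    \<open>d\<^sup>2 \<ge> \<bar>d\<bar> \<ge> 1\<close>.\<close>
  have *: "(1 - t) * ht u' + t * ht v' - ((1 - t) * ht u + t * ht v) = \<eta> * (d\<^sup>2 - 4 * \<eta> * \<sigma> * w * d)"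
    unfolding ht_def eq by (simp add: power2_eq_square field_simps)
  have "\<sigma> * w \<le> N * N"
    unfolding w_d_\<sigma>_def using assms(1-3) by (intro mult_mono) auto
  then have "16 * \<eta> * (\<sigma> * w) \<le> 16 * \<eta> * N\<^sup>2"
    using \<eta>_pos by (simp add: power2_eq_square)
  then have "16 * \<eta> * (\<sigma> * w) \<le> 1" using \<eta>_small by simp
  moreover have "0 \<le> \<eta> * (\<sigma> * w)"
    unfolding w_d_\<sigma>_def using assms(1-3) \<eta>_pos by simp
  ultimately have "\<bar>4 * \<eta> * \<sigma> * w\<bar> \<le> 1 / 2" by (simp add: mult.assoc)
  then have "\<bar>4 * \<eta> * \<sigma> * w\<bar> * \<bar>d\<bar> \<le> 1 / 2 * \<bar>d\<bar>" by (intro mult_right_mono) auto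
  then have "4 * \<eta> * \<sigma> * w * d \<le> 1 / 2 * \<bar>d\<bar>"
    by (metis abs_ge_self abs_mult order_trans)
  moreover have "1 \<le> \<bar>d\<bar>" using assms(5) by (simp add: w_d_\<sigma>_def abs_minus_commute)
  moreover have "\<bar>d\<bar> * 1 \<le> \<bar>d\<bar> * \<bar>d\<bar>" using calculation(2) by (intro mult_left_mono) auto
  ultimately have "1 / 2 \<le> d\<^sup>2 - 4 * \<eta> * \<sigma> * w * d"
    by (simp add: power2_eq_square)
  then have "\<eta> * (1 / 2) \<le> \<eta> * (d\<^sup>2 - 4 * \<eta> * \<sigma> * w * d)"
    using \<eta>_pos by (intro mult_left_mono) auto
  then show ?thesis using * by simp
qed

lemma ht_mono: "0 \<le> a \<Longrightarrow> a \<le> b \<Longrightarrow> ht a \<le> ht b"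
  unfolding ht_def using \<eta>_pos by (intro add_mono mult_left_mono power_mono) auto

lemma ht_0 [simp]: "ht 0 = 0"
  by (simp add: ht_def)

lemma ht_le:
  assumes "0 \<le> z" "z \<le> N"
  shows "ht z \<le> z + 1 / 16"
proof -
  have "\<eta> * z\<^sup>2 \<le> \<eta> * N\<^sup>2"
    using assms \<eta>_pos by (intro mult_left_mono power_mono) auto
  then show ?thesis using \<eta>_small by (simp add: ht_def)
qed

text \<open>This settles the tie between a pair and a vertex at its mean index: with half-difference
  \<open>w\<close>, the touching point is at least \<open>\<eta> * w\<^sup>2\<close> below the
  curve, and \<open>w \<ge> 1 / 2\<close>.\<close>

lemma touch_below_mean_height:
  assumes "0 \<le> u" "u + 1 \<le> v"
  defines "t \<equiv> split_param u v"
  shows "(1 - t) * ht u + t * ht v + \<eta> / 4 \<le> ht ((u + v) / 2)"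
proof -
  define w \<sigma> where "w = (v - u) / 2" "\<sigma> = (u + v) / 2"
  have eq: "u = \<sigma> - w" "v = \<sigma> + w" "t = 1 / 2 - \<eta> * w" "(u + v) / 2 = \<sigma>"
    unfolding w_\<sigma>_def t_def split_param_def by (simp_all add: field_simps)
  have *: "ht \<sigma> - ((1 - t) * ht u + t * ht v) = \<eta> * (w\<^sup>2 + 4 * \<eta> * \<sigma> * w\<^sup>2)"
    unfolding ht_def eq by (simp add: power2_eq_square field_simps)
  have "(1 / 2)\<^sup>2 \<le> w\<^sup>2" "0 \<le> \<sigma>"
    unfolding w_\<sigma>_def using assms(1,2) by (auto intro!: power_mono)
  then have "1 / 4 \<le> w\<^sup>2 + 4 * \<eta> * \<sigma> * w\<^sup>2"
    using \<eta>_pos by (simp add: power2_eq_square add_increasing2)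
  then have "\<eta> * (1 / 4) \<le> \<eta> * (w\<^sup>2 + 4 * \<eta> * \<sigma> * w\<^sup>2)"
    using \<eta>_pos by (intro mult_left_mono) auto
  then show ?thesis unfolding eq(4) using * by simp
qed

lemma touch_in_segment:
  assumes "u < v" "real v \<le> N"
  shows "touch u v \<in> closed_segment (pt u) (pt v)"
  using split_param_bounds[of u v] assms unfolding touch_def in_segment
  by (intro exI[of _ "split_param u v"]) auto

lemma touch_nth [simp]:
  "touch u v $ 1 = (1 - split_param u v) * xpos M u + split_param u v * xpos M v"
  "touch u v $ 2 = (1 - split_param u v) * ht u + split_param u v * ht v"
  by (simp_all add: touch_def)

text \<open>A horizontal error of \<open>2 / M * D\<close> changes the parameter by at most
  \<open>4 / M\<close>; the segment rises by at most \<open>2 * N\<close>, so the height changes by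
  at most \<open>8 * N / M\<close>.\<close>

lemma line_through_near:
  assumes "u' < v'" "real v' \<le> N" "D > 0" "D \<le> 2 * (xpos M v' - xpos M u')"
    and "\<bar>x - ((1 - t) * xpos M u' + t * xpos M v')\<bar> \<le> 2 / M * D"
  shows "\<bar>line_through (pt u') (pt v') x - ((1 - t) * ht u' + t * ht v')\<bar> \<le> \<eta> / 128"
proof -
  define d r where "d = xpos M v' - xpos M u'" "r = x - ((1 - t) * xpos M u' + t * xpos M v')"
  have d: "d > 0" "D \<le> 2 * d" using assms(3,4) by (auto simp: d_r_def)
  have hd: "0 \<le> ht v' - ht u'" "ht v' - ht u' \<le> 2 * N"
    using ht_mono[of "real u'" "real v'"] ht_mono[of 0 "real u'"] ht_le[of "real v'"] ht_0 assms(1,2) N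
    by simp_all
  have "(x - xpos M u') / d = t + r / d"
    using d(1) unfolding d_r_def by (simp add: field_simps)
  then have "line_through (pt u') (pt v') x - ((1 - t) * ht u' + t * ht v') = r / d * (ht v' - ht u')"
    unfolding line_through_def by (simp add: algebra_simps flip: d_r_def)
  moreover have "\<bar>r\<bar> \<le> 4 / M * d"
  proof -
    have "2 / M * D \<le> 2 / M * (2 * d)" using d M_bounds(1) by (intro mult_left_mono) auto
    then show ?thesis using assms(5) by (simp flip: d_r_def)
  qed
  then have "\<bar>r / d\<bar> \<le> 4 / M" using d(1) by (simp add: abs_divide field_simps)
  then have "\<bar>r / d\<bar> * (ht v' - ht u') \<le> 4 / M * (2 * N)"
    using hd M_bounds(1) by (intro mult_mono) auto
  moreover have "\<bar>r / d * (ht v' - ht u')\<bar> = \<bar>r / d\<bar> * (ht v' - ht u')"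
    using hd(1) by (simp only: abs_mult abs_of_nonneg)
  ultimately show ?thesis
    using M_bounds(2) by (simp only: times_divide_eq_left)
qed

lemma \<eta>_le: "\<eta> \<le> 1 / 16"
proof -
  have "\<eta> * 1 \<le> \<eta> * N\<^sup>2" using N \<eta>_pos by (intro mult_left_mono) auto
  then show ?thesis using \<eta>_small by simp
qed

text \<open>If \<open>2 * z < u + v\<close>, integrality puts the mean at least 1/2 above
  \<open>z\<close>, more than all errors. Otherwise, ties included, the touching point is
  \<open>\<eta> / 4\<close> below the curve at the mean, which is at most
  \<open>ht z\<close>.\<close>

lemma touch_vs_horizontal:
  assumes "u < v" "real v \<le> N" "real z \<le> N" "\<bar>L - ht z\<bar> \<le> \<eta> / 128"
  shows "u + v \<le> 2 * z \<Longrightarrow> touch u v $ 2 < L" "2 * z < u + v \<Longrightarrow> L < touch u v $ 2"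
proof -
  assume "u + v \<le> 2 * z"
  then have "real u + real v \<le> 2 * real z" by linarith
  then have "ht ((real u + real v) / 2) \<le> ht z" by (intro ht_mono) auto
  moreover have "touch u v $ 2 + \<eta> / 4 \<le> ht ((real u + real v) / 2)"
    using touch_below_mean_height[of "real u" "real v"] assms(1) by simp
  ultimately show "touch u v $ 2 < L" using assms(4) \<eta>_pos by linarith
next
  assume "2 * z < u + v"
  then have "2 * real z + 1 \<le> real u + real v" by linarith
  moreover have "\<bar>touch u v $ 2 - (real u + real v) / 2\<bar> \<le> 1 / 16"
    using touch_height_near_mean[of u v u v] assms(1,2) by simp
  moreover have "ht z \<le> z + 1 / 16" using ht_le[of z] assms(3) by simp
  ultimately show "L < touch u v $ 2"
    using assms(4) \<eta>_le unfolding add_divide_distrib by linarith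
qed

text \<open>The ends of the pair lie in the sibling cells \<open>2 * b\<close> and
  \<open>2 * b + 1\<close>, which start at \<open>X\<close> and \<open>X + D\<close>.\<close>

lemma xpos_at_level:
  assumes "at_level i u v" "b = u div 2 ^ Suc i"
  defines "D \<equiv> M ^ i" and "X \<equiv> M ^ i * xpos M (2 * b)"
  shows "X \<le> xpos M u" "xpos M u \<le> X + 2 / M * D" "X + D \<le> xpos M v" "xpos M v \<le> X + D + 2 / M * D"
    "u div 2 ^ i = 2 * b" "v div 2 ^ i = Suc (2 * b)"
proof -
  have "b = u div 2 ^ i div 2"
    unfolding assms(2) by (simp add: mult.commute flip: div_mult2_eq)
  then show "u div 2 ^ i = 2 * b" "v div 2 ^ i = Suc (2 * b)"
    using assms(1) by (auto simp: at_level_def)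
  then show "X \<le> xpos M u" "xpos M u \<le> X + 2 / M * D" "X + D \<le> xpos M v" "xpos M v \<le> X + D + 2 / M * D"
    using xpos_cell[of M, where i = i and u = u] xpos_cell[of M, where i = i and u = v] M_bounds(1)
    by (simp_all add: X_def D_def xpos_Suc_even algebra_simps)
qed

text \<open>One half-plane must serve the whole class, so the choice among the four separations may
  depend only on \<open>i\<close>, the block \<open>b\<close>, the common sum \<open>s\<close> and
  the pair \<open>(u', v')\<close>, not on the members of \<open>F\<close>.\<close>

lemma class_hull_avoids_segment:
  assumes e: "u' < v'" "real v' \<le> N"
    and F: "\<And>u v. (u, v) \<in> F \<Longrightarrow>
      u < v \<and> real v \<le> N \<and> pair_key u v = (i, T) \<and> (u, v) \<noteq> (u', v')"
  shows "convex hull ((\<lambda>(u, v). touch u v) ` F) \<inter> closed_segment (pt u') (pt v') = {}"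
proof -
  define b s where "b = T div 2 ^ Suc i" "s = 2 ^ Suc i * b + 2 ^ i + T - 1"
  define D X where "D = M ^ i" "X = M ^ i * xpos M (2 * b)"
  define \<kappa> where "\<kappa> = 2 / M"
  have M: "M \<ge> 2" "M \<ge> 16" using M_bounds(1) by auto
  have \<kappa>: "0 < \<kappa>" "\<kappa> \<le> 1 / 8" using M by (auto simp: \<kappa>_def field_simps)
  have D: "D > 0" using M by (simp add: D_X_def)
  have \<kappa>D: "0 < \<kappa> * D" "\<kappa> * D \<le> D / 8"
    using \<kappa> D mult_right_mono[OF \<kappa>(2), of D] by simp_all
  have FL: "at_level i u v" "b = u div 2 ^ Suc i" "u + v = s" "u < v" "real v \<le> N"
     "1 / 4 \<le> split_param u v" "split_param u v \<le> 1 / 2" if "(u, v) \<in> F" for u v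
    using F[OF that] pair_key_decode[of u v i T] split_param_bounds[of u v]
    by (auto simp: b_s_def)
  have Fx: "X \<le> xpos M u" "xpos M u \<le> X + \<kappa> * D" "X + D \<le> xpos M v" "xpos M v \<le> X + D + \<kappa> * D"
    "u div 2 ^ i = 2 * b" "v div 2 ^ i = Suc (2 * b)" if "(u, v) \<in> F" for u v
    using xpos_at_level[OF FL(1,2)[OF that], folded D_X_def \<kappa>_def] .
  \<comment> \<open>A parameter of at least 1/4 clears the left cell, whose width is at most
    \<open>D / 8\<close>; a parameter of at most 1/2 stays short of the right cell.\<close>
  have touch_x: "X + \<kappa> * D < touch u v $ 1" "touch u v $ 1 < X + D" if "(u, v) \<in> F" for u v
  proof -
    let ?t = "split_param u v"
    have t: "1 / 4 \<le> ?t" "?t \<le> 1 / 2" using FL[OF that] by auto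
    have "(1 - ?t) * X + ?t * (X + D) \<le> touch u v $ 1"
      unfolding touch_nth using t Fx[OF that] by (intro add_mono mult_left_mono) auto
    moreover have "touch u v $ 1 \<le> (1 - ?t) * (X + \<kappa> * D) + ?t * (X + D + \<kappa> * D)"
      unfolding touch_nth using t Fx[OF that] by (intro add_mono mult_left_mono) auto
    moreover have "1 / 4 * D \<le> ?t * D" "?t * D \<le> 1 / 2 * D"
      using t D by (auto intro: mult_right_mono)
    moreover have "(1 - ?t) * X + ?t * (X + D) = X + ?t * D"
      "(1 - ?t) * (X + \<kappa> * D) + ?t * (X + D + \<kappa> * D) = X + \<kappa> * D + ?t * D"
      by (simp_all add: algebra_simps)
    ultimately show "X + \<kappa> * D < touch u v $ 1" "touch u v $ 1 < X + D"
      using D \<kappa>D by linarith+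
  qed
  define i' b' where "i' = level u' v'" "b' = u' div 2 ^ Suc i'"
  define D' X' where "D' = M ^ i'" "X' = M ^ i' * xpos M (2 * b')"
  have lev': "at_level i' u' v'" unfolding i'_b'_def by (rule at_level_level[OF e(1)])
  note ex = xpos_at_level[OF lev' i'_b'_def(2), folded D'_X'_def \<kappa>_def]
  have D': "D' > 0" using M by (simp add: D'_X'_def)
  have \<kappa>D': "0 < \<kappa> * D'" "\<kappa> * D' \<le> D' / 8"
    using \<kappa> D' mult_right_mono[OF \<kappa>(2), of D'] by simp_all
  have ed: "D' \<le> 2 * (xpos M v' - xpos M u')" using ex(2,3) \<kappa>D' D' by argo
  let ?Q = "(\<lambda>(u, v). touch u v) ` F"
  let ?L = "line_through (pt u') (pt v')"
  have near: "\<bar>?L (touch u v $ 1) - ((1 - t) * ht u' + t * ht v')\<bar> \<le> \<eta> / 128"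
    if "\<bar>touch u v $ 1 - ((1 - t) * xpos M u' + t * xpos M v')\<bar> \<le> \<kappa> * D'" for u v t
    using line_through_near[OF e D' ed] that by (simp add: \<kappa>_def)
  have "(\<forall>(u, v)\<in>F. touch u v $ 1 < xpos M u') \<or> (\<forall>(u, v)\<in>F. xpos M v' < touch u v $ 1) \<or>
        (\<forall>(u, v)\<in>F. touch u v $ 2 < ?L (touch u v $ 1)) \<or>
        (\<forall>(u, v)\<in>F. ?L (touch u v $ 1) < touch u v $ 2)" (is "?A \<or> ?B \<or> ?C \<or> ?E")
  proof -
    \<comment> \<open>First the segment misses the strip of the touching points; then its ends share
      cells with those of the class; finally the whole class fits into one cell of level
      \<open>i'\<close>.\<close>
    consider "i' < i \<or> i' = i \<and> b' \<noteq> b" | "i' = i" "b' = b" | "i < i'" by linarith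
    then show ?thesis
    proof cases
      case 1
      \<comment> \<open>A pair of lower level has both ends in one cell of level \<open>i\<close>; a
        pair of the same level in another block lies entirely on one side of block
        \<open>b\<close>.\<close>
      have "v' div 2 ^ i \<le> 2 * b \<or> Suc (2 * b) \<le> u' div 2 ^ i"
      proof (cases "i' = i")
        case True
        then show ?thesis using 1 ex(5,6) by auto
      next
        case False
        then have "i' < i" using 1 by simp
        then obtain j where j: "i = Suc i' + j" using less_iff_Suc_add by auto
        have "v' div 2 ^ Suc i' = u' div 2 ^ Suc i'"
          using ex(5,6) by (simp add: mult.commute[of 2] div_mult2_eq)
        then have "v' div 2 ^ i = u' div 2 ^ i"
          unfolding j power_add div_mult2_eq by simp
        then show ?thesis by linarith
      qed
      then show ?thesis
      proof
        assume "v' div 2 ^ i \<le> 2 * b"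
        then have "M ^ i * xpos M (v' div 2 ^ i) \<le> X"
          unfolding D_X_def using M by (intro mult_left_mono xpos_mono) auto
        then have "xpos M v' \<le> X + \<kappa> * D"
          using xpos_cell(2)[OF M(1), of v' i] by (simp add: D_X_def \<kappa>_def)
        then have ?B using touch_x by fastforce
        then show ?thesis by blast
      next
        assume "Suc (2 * b) \<le> u' div 2 ^ i"
        then have "M ^ i * xpos M (Suc (2 * b)) \<le> M ^ i * xpos M (u' div 2 ^ i)"
          using M by (intro mult_left_mono xpos_mono) auto
        then have "X + D \<le> xpos M u'"
          using xpos_cell(1)[OF M(1), where u = u' and i = i]
          by (simp add: D_X_def xpos_Suc_even algebra_simps)
        then have ?A using touch_x by fastforce
        then show ?thesis by blast
      qed
    next
      case 2
      have DX: "D' = D" "X' = X" using 2 by (simp_all add: D_X_def D'_X'_def)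
      \<comment> \<open>Corresponding ends share a cell, so equal parameters give nearly equal
        abscissas and heights can be compared at the same parameter.\<close>
      have nr: "\<bar>?L (touch u v $ 1) - ((1 - split_param u v) * ht u' + split_param u v * ht v')\<bar>
        \<le> \<eta> / 128" if uv: "(u, v) \<in> F" for u v
      proof (rule near)
        let ?t = "split_param u v"
        have d: "- (\<kappa> * D) \<le> xpos M u - xpos M u'" "xpos M u - xpos M u' \<le> \<kappa> * D"
          "- (\<kappa> * D) \<le> xpos M v - xpos M v'" "xpos M v - xpos M v' \<le> \<kappa> * D"
          using Fx[OF uv] ex unfolding DX by linarith+
        have "0 \<le> ?t" "?t \<le> 1" using FL[OF uv] by linarith+
        from convex_combination_bounds[OF d this]
        show "\<bar>touch u v $ 1 - ((1 - ?t) * xpos M u' + ?t * xpos M v')\<bar> \<le> \<kappa> * D'"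
          unfolding DX touch_nth abs_le_iff by (simp add: algebra_simps)
      qed
      have mean: "\<bar>touch u v $ 2 - (real u + real v) / 2\<bar> \<le> 1 / 16"
        "\<bar>(1 - split_param u v) * ht u' + split_param u v * ht v' - (real u' + real v') / 2\<bar> \<le> 1 / 16"
        if uv: "(u, v) \<in> F" for u v
        using touch_height_near_mean[of u v u v] touch_height_near_mean[of u v u' v'] FL[OF uv] e
        by simp_all
      consider "u' + v' = s" | "s < u' + v'" | "u' + v' < s" by linarith
      then show ?thesis
      proof cases
        case 1
        have "touch u v $ 2 < ?L (touch u v $ 1)" if uv: "(u, v) \<in> F" for u v
        proof -
          have s: "u + v = u' + v'" using FL(3)[OF uv] 1 by simp
          \<comment> \<open>Here it matters that \<open>(u', v')\<close> is not in \<open>F\<close>: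
            with equal sums, \<open>u = u'\<close> would force \<open>v = v'\<close>.\<close>
          then have "u \<noteq> u'" using F[OF uv] by auto
          then have "1 \<le> \<bar>real u' - real u\<bar>" by linarith
          moreover have "real u + real v = real u' + real v'" using s by linarith
          ultimately have "touch u v $ 2 + \<eta> / 2
            \<le> (1 - split_param u v) * ht u' + split_param u v * ht v'"
            using touch_below_same_sum[of u v u' v'] FL[OF uv] by simp
          then show ?thesis using nr[OF uv] \<eta>_pos by linarith
        qed
        then have ?C by blast
        then show ?thesis by blast
      next
        case 2
        have "touch u v $ 2 < ?L (touch u v $ 1)" if uv: "(u, v) \<in> F" for u v
        proof -
          have "real u + real v + 1 \<le> real u' + real v'" using FL(3)[OF uv] 2 by linarith
          then show ?thesis using nr[OF uv] mean[OF uv] \<eta>_le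
            unfolding add_divide_distrib by linarith
        qed
        then have ?C by blast
        then show ?thesis by blast
      next
        case 3
        have "?L (touch u v $ 1) < touch u v $ 2" if uv: "(u, v) \<in> F" for u v
        proof -
          have "real u' + real v' + 1 \<le> real u + real v" using FL(3)[OF uv] 3 by linarith
          then show ?thesis using nr[OF uv] mean[OF uv] \<eta>_le
            unfolding add_divide_distrib by linarith
        qed
        then have ?E by blast
        then show ?thesis by blast
      qed
    next
      case 3
      then obtain j where j: "i' = Suc i + j" using less_iff_Suc_add by auto
      \<comment> \<open>The block of the class is contained in the single cell \<open>m\<close> of
        the coarser level \<open>i'\<close>.\<close>
      define m where "m = b div 2 ^ j"
      have m: "u div 2 ^ i' = m" "v div 2 ^ i' = m" if uv: "(u, v) \<in> F" for u v
      proof -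
        have "v div 2 ^ Suc i = b"
          using Fx(5,6)[OF uv] by (simp add: mult.commute[of 2] div_mult2_eq)
        then show "u div 2 ^ i' = m" "v div 2 ^ i' = m"
          using FL(2)[OF uv] unfolding j power_add div_mult2_eq m_def by simp_all
      qed
      have less: "x < y" if "x div 2 ^ i' < y div 2 ^ i'" for x y :: nat
        using that by (meson div_le_mono not_le)
      have cell: "M ^ i' * xpos M m \<le> touch u v $ 1" "touch u v $ 1 \<le> M ^ i' * xpos M m + \<kappa> * D'"
        if uv: "(u, v) \<in> F" for u v
      proof -
        have c: "M ^ i' * xpos M m \<le> xpos M u" "xpos M u \<le> M ^ i' * xpos M m + \<kappa> * D'"
          "M ^ i' * xpos M m \<le> xpos M v" "xpos M v \<le> M ^ i' * xpos M m + \<kappa> * D'"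
          using xpos_cell[OF M(1), where i = i' and u = u] xpos_cell[OF M(1), where i = i' and u = v]
            m[OF uv] by (simp_all add: D'_X'_def \<kappa>_def)
        have "0 \<le> split_param u v" "split_param u v \<le> 1" using FL[OF uv] by linarith+
        from convex_combination_bounds[OF c this]
        show "M ^ i' * xpos M m \<le> touch u v $ 1" "touch u v $ 1 \<le> M ^ i' * xpos M m + \<kappa> * D'"
          unfolding touch_nth .
      qed
      \<comment> \<open>Over the cell of an end \<open>z\<close>, the segment has nearly the height
        \<open>ht z\<close>, and comparing \<open>s\<close> with \<open>2 * z\<close> decides the
        side for all touching points at once.\<close>
      have horizontal: ?thesis if z: "real z \<le> N"
        and L: "\<And>u v. (u, v) \<in> F \<Longrightarrow> \<bar>?L (touch u v $ 1) - ht z\<bar> \<le> \<eta> / 128" for z :: nat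
      proof (cases "s \<le> 2 * z")
        case True
        have "touch u v $ 2 < ?L (touch u v $ 1)" if uv: "(u, v) \<in> F" for u v
          using touch_vs_horizontal(1)[OF FL(4,5)[OF uv] z L[OF uv]] FL(3)[OF uv] True by simp
        then have ?C by blast
        then show ?thesis by blast
      next
        case False
        have "?L (touch u v $ 1) < touch u v $ 2" if uv: "(u, v) \<in> F" for u v
          using touch_vs_horizontal(2)[OF FL(4,5)[OF uv] z L[OF uv]] FL(3)[OF uv] False by simp
        then have ?E by blast
        then show ?thesis by blast
      qed
      \<comment> \<open>The two ends are in consecutive cells, so the class lies left of the
        segment, in the cell of one of its ends, or right of it.\<close>
      consider "m < 2 * b'" | "m = 2 * b'" | "m = Suc (2 * b')" | "Suc (2 * b') < m" by linarith
      then show ?thesis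
      proof cases
        case 1
        have "touch u v $ 1 < xpos M u'" if uv: "(u, v) \<in> F" for u v
        proof -
          have "u < u'" "v < u'" using less[of u u'] less[of v u'] m[OF uv] 1 ex(5) by simp_all
          then have "xpos M u \<le> xpos M u' - 1" "xpos M v \<le> xpos M u' - 1"
            by (simp_all add: le_diff_eq xpos_gap[OF M(1)])
          then have "touch u v $ 1 \<le> xpos M u' - 1"
            unfolding touch_nth using FL[OF uv]
            by (intro convex_combination_bounds(2)[where a = "min (xpos M u) (xpos M v)"]) auto
          then show ?thesis by simp
        qed
        then have ?A by blast
        then show ?thesis by blast
      next
        case 4
        have "xpos M v' < touch u v $ 1" if uv: "(u, v) \<in> F" for u v
        proof -
          have "v' < u" "v' < v" using less[of v' u] less[of v' v] m[OF uv] 4 ex(6) by simp_all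
          then have "xpos M v' + 1 \<le> xpos M u" "xpos M v' + 1 \<le> xpos M v"
            by (simp_all add: xpos_gap[OF M(1)])
          then have "xpos M v' + 1 \<le> touch u v $ 1"
            unfolding touch_nth using FL[OF uv]
            by (intro convex_combination_bounds(1)[where b = "max (xpos M u) (xpos M v)"]) auto
          then show ?thesis by simp
        qed
        then have ?B by blast
        then show ?thesis by blast
      next
        case m2: 2
        show ?thesis
        proof (rule horizontal)
          show "real u' \<le> N" using e by simp
          fix u v assume uv: "(u, v) \<in> F"
          have "\<bar>touch u v $ 1 - xpos M u'\<bar> \<le> \<kappa> * D'"
            using cell[OF uv] ex unfolding m2 D'_X'_def(2)[symmetric] by linarith
          then show "\<bar>?L (touch u v $ 1) - ht u'\<bar> \<le> \<eta> / 128"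
            using near[where u = u and v = v and t = 0] by (simp del: touch_nth)
        qed
      next
        case m3: 3
        show ?thesis
        proof (rule horizontal)
          show "real v' \<le> N" using e by simp
          fix u v assume uv: "(u, v) \<in> F"
          have "M ^ i' * xpos M m = X' + D'"
            unfolding m3 D'_X'_def by (simp add: xpos_Suc_even algebra_simps)
          then have "\<bar>touch u v $ 1 - xpos M v'\<bar> \<le> \<kappa> * D'"
            using cell[OF uv] ex by linarith
          then show "\<bar>?L (touch u v $ 1) - ht v'\<bar> \<le> \<eta> / 128"
            using near[where u = u and v = v and t = 1] by (simp del: touch_nth)
        qed
      qed
    qed
  qed
  moreover have "pt u' $ 1 < pt v' $ 1" using xpos_gap[OF M(1) e(1)] by simp
  ultimately show ?thesis
    by (intro convex_hull_Int_segment_eq_empty_2) (auto simp del: touch_nth)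
qed

end

subsection \<open>The obstacles\<close>

lemma obstacle_representation_exists:
  fixes E :: "'a set set"
  assumes V: "finite V" "card V = n" and n: "1 \<le> n" "n \<le> 2 ^ k"
  obtains p Obs where "finite Obs" "obstacle_representation V E p Obs" "\<forall>P\<in>Obs. convex P"
    "card Obs + n \<le> n * k + 1"
proof -
  \<comment> \<open>These values give equality in both conditions:
    \<open>16 * \<eta> * N\<^sup>2 = 1\<close> and \<open>M * \<eta> = 1024 * N\<close>.\<close>
  define N \<eta> M where "N = real n" "\<eta> = 1 / (16 * N\<^sup>2)" "M = 1024 * N / \<eta>"
  have N: "N \<ge> 1" using n by (simp add: N_\<eta>_M_def)
  interpret dyadic_drawing N \<eta> M
    using N by unfold_locales (simp_all add: N_\<eta>_M_def(2,3))
  obtain h where h: "bij_betw h V {0..<n}"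
    using ex_bij_betw_finite_nat[OF V(1)] V(2) by auto
  define g where "g = inv_into V h"
  define edge where "edge u v \<longleftrightarrow> {g u, g v} \<in> E" for u v
  define K where "K = class_keys n k"
  define F where "F c = {(u, v). u < v \<and> v < n \<and> pair_key u v = c \<and> \<not> edge u v}" for c
  \<comment> \<open>All edges together form a closed set, so a hull disjoint from it can be fattened
    without meeting an edge.\<close>
  define C where "C = (\<Union>(u, v)\<in>{(u, v). u < v \<and> v < n \<and> edge u v}. closed_segment (pt u) (pt v))"
  have fin: "finite {(u, v). u < v \<and> v < n \<and> Q u v}" for Q
    by (rule finite_subset[of _ "{..<n} \<times> {..<n}"]) auto
  have "closed C"
    unfolding C_def using fin[of edge] by (intro closed_UN) auto
  have "\<exists>P. polygon P \<and> convex P \<and> (\<lambda>(u, v). touch u v) ` F c \<subseteq> P \<and> P \<inter> C = {}"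
    if "F c \<noteq> {}" for c
  proof -
    let ?Q = "(\<lambda>(u, v). touch u v) ` F c"
    have "convex hull ?Q \<inter> closed_segment (pt u) (pt v) = {}" if "u < v" "v < n" "edge u v" for u v
      using that by (intro class_hull_avoids_segment[of u v "F c" "fst c" "snd c"])
        (auto simp: F_def N_\<eta>_M_def(1))
    then have "convex hull ?Q \<inter> C = {}" unfolding C_def by fast
    moreover have "finite ?Q" unfolding F_def by (intro finite_imageI fin)
    ultimately show ?thesis
      using convex_polygon_around_finite_set[OF _ _ \<open>closed C\<close>] \<open>F c \<noteq> {}\<close> by (metis image_is_empty)
  qed
  then obtain P where P: "\<And>c. F c \<noteq> {} \<Longrightarrow> polygon (P c)" "\<And>c. F c \<noteq> {} \<Longrightarrow> convex (P c)"
    "\<And>c. F c \<noteq> {} \<Longrightarrow> (\<lambda>(u, v). touch u v) ` F c \<subseteq> P c" "\<And>c. F c \<noteq> {} \<Longrightarrow> P c \<inter> C = {}"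
    by metis
  \<comment> \<open>\<open>P c\<close> is specified only for nonempty \<open>F c\<close>. Empty
    classes and coinciding polygons can only lower the count.\<close>
  define Obs where "Obs = P ` {c \<in> K. F c \<noteq> {}}"
  have finK: "finite K" unfolding K_def by (rule finite_class_keys)
  have iff: "edge a b \<longleftrightarrow> (\<forall>R\<in>Obs. closed_segment (pt a) (pt b) \<inter> R = {})"
    if ab: "a < b" "b < n" for a b
  proof
    assume "edge a b"
    then have "closed_segment (pt a) (pt b) \<subseteq> C" unfolding C_def using ab by blast
    then show "\<forall>R\<in>Obs. closed_segment (pt a) (pt b) \<inter> R = {}"
      unfolding Obs_def using P(4) by blast
  next
    assume *: "\<forall>R\<in>Obs. closed_segment (pt a) (pt b) \<inter> R = {}"
    show "edge a b"
    proof (rule ccontr)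
      assume "\<not> edge a b"
      define c where "c = pair_key a b"
      have abF: "(a, b) \<in> F c" using \<open>\<not> edge a b\<close> ab by (simp add: F_def c_def)
      then have "touch a b \<in> P c" using P(3)[of c] by fastforce
      moreover have "P c \<in> Obs"
        unfolding Obs_def K_def c_def using abF pair_key_in_class_keys[OF ab n(2)] c_def by blast
      moreover have "touch a b \<in> closed_segment (pt a) (pt b)"
        using ab by (intro touch_in_segment) (simp_all add: N_\<eta>_M_def(1))
      ultimately show False using * by blast
    qed
  qed
  have gh: "g (h u) = u" if "u \<in> V" for u
    unfolding g_def using h that by (simp add: bij_betw_def inv_into_f_f)
  have hlt: "h u < n" if "u \<in> V" for u
    using h that by (auto simp: bij_betw_def)
  have hinj: "inj_on h V" using h by (simp add: bij_betw_def)
  show thesis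
  proof
    show "finite Obs" unfolding Obs_def using finK by simp
    show "\<forall>P\<in>Obs. convex P" unfolding Obs_def using P(2) by blast
    have "card Obs \<le> card K"
      unfolding Obs_def using finK
      by (intro order_trans[OF card_image_le card_mono]) auto
    then show "card Obs + n \<le> n * k + 1"
      using card_class_keys[OF n] unfolding K_def by simp
    show "obstacle_representation V E (pt \<circ> h) Obs"
      unfolding obstacle_representation_def
    proof (intro conjI ballI impI)
      have "inj pt"
      proof (rule linorder_injI)
        fix x y :: nat assume "x < y"
        then have "pt x $ 1 < pt y $ 1"
          using xpos_gap[of M x y] M_bounds(1) by simp
        then show "pt x \<noteq> pt y" by force
      qed
      then show "inj_on (pt \<circ> h) V"
        using hinj by (auto intro: comp_inj_on inj_on_subset)
      show "polygon R" if "R \<in> Obs" for R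
        using that P(1) unfolding Obs_def by blast
      show "{u, v} \<in> E \<longleftrightarrow> (\<forall>R\<in>Obs. closed_segment ((pt \<circ> h) u) ((pt \<circ> h) v) \<inter> R = {})"
        if uv: "u \<in> V" "v \<in> V" "u \<noteq> v" for u v
      proof (cases "h u < h v")
        case True
        then show ?thesis
          using iff[of "h u" "h v"] uv hlt by (simp add: edge_def gh)
      next
        case False
        then have "h v < h u"
          using uv inj_onD[OF hinj] by (meson linorder_neqE_nat)
        then show ?thesis
          using iff[of "h v" "h u"] uv hlt
          by (simp add: edge_def gh insert_commute closed_segment_commute)
      qed
    qed
  qed
qed

lemma le_two_power_ceiling_log:
  assumes "n \<ge> 1"
  shows "real n \<le> 2 ^ nat \<lceil>log 2 (real n)\<rceil>"
proof -
  have "real n = 2 powr log 2 (real n)" using assms by simp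
  also have "\<dots> \<le> 2 powr real (nat \<lceil>log 2 (real n)\<rceil>)"
    by (intro powr_mono) (use assms in \<open>auto intro: real_nat_ceiling_ge\<close>)
  finally show ?thesis by (simp add: powr_realpow)
qed

theorem theorem2:
  fixes n :: nat and V :: "'a set" and E :: "'a set set"
  assumes "n \<ge> 1" and "simple_graph V E" and "card V = n"
  shows "ereal_of_enat (convex_obstacle_number V E)
           \<le> ereal (real n * real_of_int \<lceil>log 2 (real n)\<rceil> - real n + 1)"
proof -
  define k where "k = nat \<lceil>log 2 (real n)\<rceil>"
  \<comment> \<open>Nonnegativity ensures that \<open>nat\<close> in the definition of
    \<open>k\<close> does not truncate the ceiling.\<close>
  have "0 \<le> log 2 (real n)" using assms(1) by simp
  then have k: "real_of_int \<lceil>log 2 (real n)\<rceil> = real k"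
    unfolding k_def by simp
  have "real n \<le> 2 ^ k"
    unfolding k_def by (rule le_two_power_ceiling_log[OF assms(1)])
  then have "n \<le> 2 ^ k"
    by (metis of_nat_le_iff of_nat_numeral of_nat_power)
  then obtain p Obs where "finite Obs" "obstacle_representation V E p Obs" "\<forall>P\<in>Obs. convex P"
    and card: "card Obs + n \<le> n * k + 1"
    using obstacle_representation_exists[of V n k E] assms unfolding simple_graph_def by metis
  then have "convex_obstacle_number V E \<le> enat (card Obs)"
    unfolding convex_obstacle_number_def by (intro Inf_lower) blast
  then have "ereal_of_enat (convex_obstacle_number V E) \<le> ereal_of_enat (enat (card Obs))"
    by (simp only: ereal_of_enat_le_iff)
  also have "\<dots> = ereal (real (card Obs))" by simp
  also have "real (card Obs) \<le> real n * real k - real n + 1"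
  proof -
    have "real (card Obs + n) \<le> real (n * k + 1)" using card by (rule of_nat_mono)
    then show ?thesis by simp
  qed
  finally show ?thesis by (simp add: k)
qed

end
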